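(* Let $V=\mathbb{F}_q^n$ and let $G$ be one of $\mathrm{GL}(V)$ or $\mathrm{PGL}(V)$. Let $H$ be a subgroup of $G$. Then $$\mu(H,G)=\mu_{\widehat{\mathcal{I}}(G,H)}(H,G)+\sum_{\substack{H<K<G\\ K\notin\mathcal{I}(G,H)}}\mu(K,G)\cdot\mu_{\widehat{\mathcal{I}}(K,H)}(H,K)=\sum_{K\in\mathit{Irr}(G,H)}\mu(K,G)\cdot\mu_{\widehat{\mathcal{I}}(K,H)}(H,K).$$
   Context: $\mathbb{F}_q$ is the finite field with $q$ elements and $V=\mathbb{F}_q^n$. $G=\mathrm{GL}(V)$ acts naturally on the lattice of subspaces of $V$, and $G=\mathrm{PGL}(V)=\mathrm{GL}(V)/Z(\mathrm{GL}(V))$ acts on it by the induced action; $W^g$ denotes the image of $W$ under $g$. A subspace $W\leq V$ is $H$-invariant if $W^h=W$ for all $h\in H$. A subgroup $H\leq G$ is irreducible if its only invariant subspaces are $0$ and $V$, and reducible otherwise. $\mathit{Irr}(G,H)$ is the set of irreducible subgroups of $G$ that contain $H$. For $H\leq K\leq G$ with $K$ irreducible, let $\mathcal{C}(K,H):=\{\mathrm{stab}_K(W)\mid 0<W<V,\ H\subseteq\mathrm{stab}_K(W)\}$, where $\mathrm{stab}_K(W)=\{g\in K: W^g=W\}$; let $\mathcal{I}(K,H):=\{L\leq K\mid H\leq L\leq M\text{ for some }M\in\mathcal{C}(K,H)\}$; and let $\widehat{\mathcal{I}}(K,H):=\mathcal{I}(K,H)\cup\{H,K\}$, a poset under inclusion.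 The group $G$ itself is irreducible, so this also defines $\mathcal{I}(G,H)$ and $\widehat{\mathcal{I}}(G,H)$. For a finite poset $(P,\leq)$, the Möbius function $\mu_P:P\times P\to\mathbb{Z}$ is defined by $\mu_P(y,y)=1$, $\sum_{x\leq t\leq y}\mu_P(t,y)=0$ if $x<y$, and $\mu_P(x,y)=0$ unless $x\leq y$. $\mu$ without subscript denotes the Möbius function of the lattice of all subgroups of $G$ containing $H$, ordered by inclusion.
   Formalization: The second equality (sum over Irr(G,H)) is stated only for H reducible or H = G: for irreducible H < G the last sum equals 2μ(H,G), so it fails when μ(H,G) ≠ 0, e.g. H = C_3 in GL_2(2). The first equality holds for all H; n ≥ 1. *)

theory Defs
  imports "HOL-Analysis.Analysis" "HOL-Algebra.Group_Action"
begin

section \<open>The Moebius function of a finite poset\<close>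

text \<open>
  The poset is a finite set \<^term>\<open>P\<close> with the order of its ambient type; for the sets of subgroups
  used below this order is inclusion.  The value is 0 if an argument lies outside \<^term>\<open>P\<close>.
\<close>

function moebius :: "'a::order set \<Rightarrow> 'a \<Rightarrow> 'a \<Rightarrow> int" where
  "moebius P x y =
     (if finite P \<and> x \<in> P \<and> y \<in> P \<and> x \<le> y
      then if x = y then 1 else - (\<Sum>t\<in>{t \<in> P. x < t \<and> t \<le> y}. moebius P t y)
      else 0)"
  by pat_completeness auto
termination
proof (relation "Wellfounded.measure (\<lambda>(P, x, y). card {t \<in> P. x < t})", goal_cases)
  case 1
  then show ?case by simp
next
  case (2 P x y t)
  then have "{s \<in> P. t < s} \<subset> {s \<in> P. x < s}" by auto
  with 2 show ?case by (simp add: psubset_card_mono)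
qed

declare moebius.simps [simp del]

lemma moebius_refl: "finite P \<Longrightarrow> y \<in> P \<Longrightarrow> moebius P y y = 1"
  by (simp add: moebius.simps)

lemma moebius_eq_0: "\<not> x \<le> y \<Longrightarrow> moebius P x y = 0"
  by (simp add: moebius.simps)

lemma moebius_sum:
  assumes "finite P" "x \<in> P" "y \<in> P" "x < y"
  shows "(\<Sum>t\<in>{t \<in> P. x \<le> t \<and> t \<le> y}. moebius P t y) = 0"
proof -
  have "{t \<in> P. x \<le> t \<and> t \<le> y} = insert x {t \<in> P. x < t \<and> t \<le> y}"
    using assms by auto
  then show ?thesis
    using assms by (simp add: moebius.simps [of P x y])
qed


section \<open>Groups acting on the subspaces of a vector space\<close>

text \<open>
  In this section \<^term>\<open>G\<close> is a group, \<^term>\<open>\<phi>\<close> gives the action of its elements on the subspaces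
  of \<open>'a^'n\<close>, and \<^term>\<open>H\<close>, \<^term>\<open>K\<close> are carriers of subgroups of \<^term>\<open>G\<close>.
  The sets \<open>C(K,H)\<close>, \<open>I(K,H)\<close> and \<open>I(K,H) \<union> {H, K}\<close> are called \<open>stab_family\<close>, \<open>stab_ideal\<close> and
  \<open>stab_ideal_hat\<close>.
\<close>

definition invariant_subspace ::
    "('g \<Rightarrow> ('a::field^'n) set \<Rightarrow> ('a^'n) set) \<Rightarrow> 'g set \<Rightarrow> ('a^'n) set \<Rightarrow> bool" where
  "invariant_subspace \<phi> H W \<longleftrightarrow> vec.subspace W \<and> (\<forall>h\<in>H. \<phi> h W = W)"

definition irreducible_subgroup ::
    "('g \<Rightarrow> ('a::field^'n) set \<Rightarrow> ('a^'n) set) \<Rightarrow> 'g set \<Rightarrow> bool" where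
  "irreducible_subgroup \<phi> H \<longleftrightarrow> (\<forall>W. invariant_subspace \<phi> H W \<longrightarrow> W = {0} \<or> W = UNIV)"

definition overgroups :: "('g, 'm) monoid_scheme \<Rightarrow> 'g set \<Rightarrow> 'g set set" where
  "overgroups G H = {K. subgroup K G \<and> H \<subseteq> K}"

definition Irr ::
    "('g, 'm) monoid_scheme \<Rightarrow> ('g \<Rightarrow> ('a::field^'n) set \<Rightarrow> ('a^'n) set) \<Rightarrow> 'g set \<Rightarrow> 'g set set" where
  "Irr G \<phi> H = {K \<in> overgroups G H. irreducible_subgroup \<phi> K}"

definition stab_family ::
    "('g, 'm) monoid_scheme \<Rightarrow> ('g \<Rightarrow> ('a::field^'n) set \<Rightarrow> ('a^'n) set)
      \<Rightarrow> 'g set \<Rightarrow> 'g set \<Rightarrow> 'g set set" where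
  "stab_family G \<phi> K H =
     {stabilizer (G\<lparr>carrier := K\<rparr>) \<phi> W | W.
        vec.subspace W \<and> W \<noteq> {0} \<and> W \<noteq> UNIV \<and> H \<subseteq> stabilizer (G\<lparr>carrier := K\<rparr>) \<phi> W}"

definition stab_ideal ::
    "('g, 'm) monoid_scheme \<Rightarrow> ('g \<Rightarrow> ('a::field^'n) set \<Rightarrow> ('a^'n) set)
      \<Rightarrow> 'g set \<Rightarrow> 'g set \<Rightarrow> 'g set set" where
  "stab_ideal G \<phi> K H =
     {L. subgroup L G \<and> L \<subseteq> K \<and> H \<subseteq> L \<and> (\<exists>M\<in>stab_family G \<phi> K H. L \<subseteq> M)}"

definition stab_ideal_hat ::
    "('g, 'm) monoid_scheme \<Rightarrow> ('g \<Rightarrow> ('a::field^'n) set \<Rightarrow> ('a^'n) set)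
      \<Rightarrow> 'g set \<Rightarrow> 'g set \<Rightarrow> 'g set set" where
  "stab_ideal_hat G \<phi> K H = stab_ideal G \<phi> K H \<union> {H, K}"


section \<open>The groups GL(V) and PGL(V)\<close>

definition GL :: "('a::field^'n \<Rightarrow> 'a^'n) monoid" where
  "GL = \<lparr>carrier = {f. Vector_Spaces.linear (*s) (*s) f \<and> bij f}, mult = (\<circ>), one = id\<rparr>"

definition group_center :: "('g, 'm) monoid_scheme \<Rightarrow> 'g set" where
  "group_center G = {z \<in> carrier G. \<forall>g\<in>carrier G. z \<otimes>\<^bsub>G\<^esub> g = g \<otimes>\<^bsub>G\<^esub> z}"

definition PGL :: "('a::field^'n \<Rightarrow> 'a^'n) set monoid" where
  "PGL = GL Mod group_center GL"

definition GL_action :: "('a::field^'n \<Rightarrow> 'a^'n) \<Rightarrow> ('a^'n) set \<Rightarrow> ('a^'n) set" where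
  "GL_action g W = g ` W"

text \<open>
  All elements \<^term>\<open>g\<close> of a coset \<^term>\<open>X\<close> of the center have the same image \<open>g ` W\<close> of a subspace
  \<^term>\<open>W\<close>, so the union below is this common image (lemma \<open>PGL_action_coset\<close>).
\<close>

definition PGL_action :: "('a::field^'n \<Rightarrow> 'a^'n) set \<Rightarrow> ('a^'n) set \<Rightarrow> ('a^'n) set" where
  "PGL_action X W = (\<Union>g\<in>X. GL_action g W)"

lemma group_GL: "group (GL :: ('a::field^'n \<Rightarrow> 'a^'n) monoid)"
proof (rule groupI, goal_cases)
  case (1 x y)
  then show ?case
    by (auto simp: GL_def bij_comp intro: linear_compose Vector_Spaces.linear_compose)
next
  case 2
  then show ?case by (auto simp: GL_def vec.linear_id[unfolded id_def] id_def bij_def)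
next
  case (3 x y z)
  then show ?case by (simp add: GL_def comp_assoc)
next
  case (4 x)
  then show ?case by (simp add: GL_def)
next
  case (5 f)
  then have f: "Vector_Spaces.linear (*s) (*s) f" "bij f" by (auto simp: GL_def)
  interpret f: Vector_Spaces.linear "(*s)" "(*s)" f by (fact f(1))
  have s: "f (inv_into UNIV f x) = x" for x
    using f(2) by (simp add: bij_is_surj surj_f_inv_f)
  have i: "inv_into UNIV f (f x) = x" for x
    using f(2) by (simp add: bij_is_inj)
  have "Vector_Spaces.linear (*s) (*s) (inv_into UNIV f)"
    by unfold_locales (metis s i f.add f.scale)+
  moreover have "bij (inv_into UNIV f)" using f(2) by (rule bij_imp_bij_inv)
  moreover have "inv_into UNIV f \<circ> f = id" using i by auto
  ultimately show ?case by (auto simp: GL_def)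
qed

lemma center_scalar:
  fixes z :: "'a::field^'n \<Rightarrow> 'a^'n"
  assumes "z \<in> group_center GL"
  shows "z v \<in> vec.span {v}"
proof (rule ccontr)
  assume n: "z v \<notin> vec.span {v}"
  have z: "Vector_Spaces.linear (*s) (*s) z" using assms by (simp add: group_center_def GL_def)
  interpret z: Vector_Spaces.linear "(*s)" "(*s)" z by (fact z)
  have v: "v \<noteq> 0" using n z.zero by (auto simp: vec.span_zero)
  have ne: "z v \<noteq> v" using n vec.span_base by fastforce
  have ind: "vec.independent {z v, v}"
    using n v vec.independent_insert[of "z v" "{v}"] vec.dependent_single by auto
  define B where "B = vec.extend_basis {z v, v}"
  have B: "{z v, v} \<subseteq> B" "vec.independent B" "vec.span B = UNIV"
    using vec.extend_basis_superset[OF ind] vec.independent_extend_basis[OF ind]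
      vec.span_extend_basis[OF ind] by (simp_all add: B_def)
  define g where "g = vec.construct B (\<lambda>b. if b = z v then z v + v else b)"
  define h where "h = vec.construct B (\<lambda>b. if b = z v then z v - v else b)"
  have lg: "Vector_Spaces.linear (*s) (*s) g" and lh: "Vector_Spaces.linear (*s) (*s) h"
    unfolding g_def h_def by (rule vec.linear_construct[OF B(2)])+
  interpret g: Vector_Spaces.linear "(*s)" "(*s)" g by (fact lg)
  interpret h: Vector_Spaces.linear "(*s)" "(*s)" h by (fact lh)
  have gB: "b \<in> B \<Longrightarrow> g b = (if b = z v then z v + v else b)"
   and hB: "b \<in> B \<Longrightarrow> h b = (if b = z v then z v - v else b)" for b
    unfolding g_def h_def by (auto simp: vec.construct_basis[OF B(2)])
  have gv: "g v = v" "g (z v) = z v + v" and hv: "h v = v" "h (z v) = z v - v"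
    using B(1) ne gB hB by auto
  have gh: "g (h b) = b" "h (g b) = b" if "b \<in> B" for b
    using that gB hB gv hv ne by (auto simp: g.diff h.add)
  have "(g \<circ> h) x = id x" "(h \<circ> g) x = id x" for x
    using vec.linear_eq_on_span[OF Vector_Spaces.linear_compose[OF lh lg] vec.linear_id, of B]
      vec.linear_eq_on_span[OF Vector_Spaces.linear_compose[OF lg lh] vec.linear_id, of B] gh B(3)
    by auto
  then have "bij g" by (metis ext o_bij)
  with lg have "g \<in> carrier GL" by (simp add: GL_def)
  with assms have "z \<circ> g = g \<circ> z" by (auto simp: group_center_def GL_def)
  then have "z (g v) = g (z v)" by (metis comp_apply)
  with gv v show False by simp
qed

lemma PGL_action_coset:
  fixes g :: "'a::field^'n \<Rightarrow> 'a^'n"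
  assumes g: "g \<in> carrier GL" and W: "vec.subspace W"
  shows "PGL_action (group_center GL #>\<^bsub>GL\<^esub> g) W = GL_action g W"
proof -
  have lg: "Vector_Spaces.linear (*s) (*s) g" using g by (simp add: GL_def)
  have gW: "vec.subspace (g ` W)" by (rule vec.linear_subspace_image[OF lg W])
  have 1: "z (g w) \<in> g ` W" if "z \<in> group_center GL" "w \<in> W" for z w
    using center_scalar[OF that(1), of "g w"] vec.span_minimal[of "{g w}" "g ` W"] gW that(2)
    by auto
  have "id \<in> group_center (GL :: ('a^'n \<Rightarrow> 'a^'n) monoid)"
    using monoid.one_closed[OF group.is_monoid[OF group_GL]]
    by (auto simp: group_center_def GL_def)
  then have "id \<otimes>\<^bsub>GL\<^esub> g \<in> group_center GL #>\<^bsub>GL\<^esub> g" by (auto simp: r_coset_def)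
  then have 2: "g ` W \<subseteq> PGL_action (group_center GL #>\<^bsub>GL\<^esub> g) W"
    unfolding PGL_action_def GL_action_def by (intro UN_upper) (simp add: GL_def)
  have 3: "PGL_action (group_center GL #>\<^bsub>GL\<^esub> g) W \<subseteq> g ` W"
    using 1 by (auto simp: PGL_action_def GL_action_def r_coset_def GL_def)
  from 2 3 show ?thesis by (simp add: GL_action_def)
qed

lemma normal_center:
  fixes G (structure)
  assumes "group G"
  shows "group_center G \<lhd> G"
proof -
  interpret group G by (fact assms)
  have inv: "inv z \<otimes> g = g \<otimes> inv z" if z: "z \<in> group_center G" and g: "g \<in> carrier G" for z g
  proof -
    have zc: "z \<in> carrier G" "z \<otimes> g = g \<otimes> z" using z g unfolding group_center_def by blast+
    have "inv z \<otimes> g = inv z \<otimes> (g \<otimes> z) \<otimes> inv z"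
      using zc(1) g by (simp add: m_assoc)
    also have "\<dots> = inv z \<otimes> (z \<otimes> g) \<otimes> inv z"
      by (simp only: zc(2))
    also have "\<dots> = g \<otimes> inv z"
      using zc(1) g by (simp flip: m_assoc)
    finally show ?thesis .
  qed
  have mult: "x \<otimes> y \<otimes> g = g \<otimes> (x \<otimes> y)"
    if "x \<in> group_center G" "y \<in> group_center G" "g \<in> carrier G" for x y g
  proof -
    have c: "x \<in> carrier G" "y \<in> carrier G" "x \<otimes> g = g \<otimes> x" "y \<otimes> g = g \<otimes> y"
      using that unfolding group_center_def by blast+
    have "x \<otimes> y \<otimes> g = x \<otimes> (y \<otimes> g)" using c(1,2) that(3) by (simp add: m_assoc)
    also have "\<dots> = x \<otimes> g \<otimes> y" unfolding c(4) using c(1,2) that(3) by (simp add: m_assoc)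
    also have "\<dots> = g \<otimes> (x \<otimes> y)" unfolding c(3) using c(1,2) that(3) by (simp add: m_assoc)
    finally show ?thesis .
  qed
  have sub: "subgroup (group_center G) G"
  proof
    show "x \<otimes> y \<in> group_center G" if "x \<in> group_center G" "y \<in> group_center G" for x y
      using mult[OF that] that unfolding group_center_def by blast
    show "inv x \<in> group_center G" if "x \<in> group_center G" for x
      using inv[OF that] that unfolding group_center_def by blast
  qed (simp_all add: group_center_def subset_iff)
  have "x \<otimes> z \<otimes> inv x = z" if "x \<in> carrier G" "z \<in> group_center G" for x z
  proof -
    have c: "z \<in> carrier G" "x \<otimes> z = z \<otimes> x"
      using that unfolding group_center_def by (blast, metis (mono_tags, lifting) mem_Collect_eq)
    have "x \<otimes> z \<otimes> inv x = z \<otimes> x \<otimes> inv x" by (simp only: c(2))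
    also have "\<dots> = z" using c(1) that(1) by (simp add: m_assoc)
    finally show ?thesis .
  qed
  with sub show ?thesis by (intro normal_invI) simp_all
qed

lemma group_PGL: "group (PGL :: ('a::field^'n \<Rightarrow> 'a^'n) set monoid)"
  unfolding PGL_def by (rule normal.factorgroup_is_group[OF normal_center[OF group_GL]])

end

theory Submission
  imports Defs
begin

text \<open>
  The formula is an instance of a fact on arbitrary finite posets, \<open>moebius_split_at_subset\<close>.  Split
  a finite poset \<open>P\<close> into a part \<open>J\<close> and its complement.  For \<open>x\<close> in \<open>J\<close> and \<open>b\<close> outside \<open>J\<close>, the
  number \<open>\<mu>(x,b)\<close> is recovered from the numbers \<open>\<mu>(K,b)\<close> with \<open>K\<close> outside \<open>J\<close>: each of them is
  weighted by the Moebius function, between \<open>x\<close> and \<open>K\<close>, of the poset \<open>J\<^sub>K\<close> formed by \<open>K\<close> and the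
  elements of \<open>J\<close> below it.  The weighted sum satisfies the recursion that defines \<open>\<mu>(x,b)\<close>, because
  for each single \<open>K\<close> the weights satisfy the recursion in \<open>J\<^sub>K\<close>.

  Here \<open>P\<close> consists of the subgroups containing \<open>H\<close>, and \<open>J\<close> of the reducible ones together with
  \<open>H\<close>.  A subgroup lies below the stabilizer of a proper nonzero subspace exactly if it is reducible
  (\<open>stab_ideal_eq\<close>), so \<open>J\<^sub>K\<close> is \<open>stab_ideal_hat G \<phi> K H\<close>.  For \<open>H \<noteq> G\<close> the fact can be applied with
  \<open>b = G\<close> because \<open>G\<close> itself is irreducible: every nonzero vector is mapped to every vector
  outside its span by some invertible linear map.  The first formula isolates the summand \<open>K = G\<close>.
  In the second one the sum runs over the complement of the reducible subgroups, which is the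
  complement of \<open>J\<close> if \<open>H\<close> is reducible.  For \<open>H = G\<close> both formulas say \<open>1 = 1\<close>.
\<close>

text \<open>
  By induction from the top, \<open>\<mu>(t,b)\<close> may be expanded for all \<open>t > x\<close> in \<open>J\<close>.  After exchanging the
  two sums, the coefficient of \<open>\<mu>(K,b)\<close> is the negative of the sum of the values \<open>\<mu>(t,K)\<close> over
  \<open>t > x\<close> in the poset of \<open>K\<close> and the elements of \<open>J\<close> below it, where \<open>K\<close> itself contributes the
  summand 1.  This is the recursion for the weight of \<open>x\<close> in that poset.
\<close>

lemma moebius_split_at_subset:
  fixes P J :: "'a::order set"
  assumes P: "finite P" and J: "J \<subseteq> P" and b: "b \<in> P" "b \<notin> J" and x: "x \<in> J"
  shows "moebius P x b = (\<Sum>K\<in>P - J. moebius P K b * moebius (insert K {t \<in> J. t \<le> K}) x K)"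
  using x
proof (induction "card {t \<in> P. x < t}" arbitrary: x rule: less_induct)
  case less
  define f where "f t K = moebius (insert K {t \<in> J. t \<le> K}) t K" for t K
  have finJ: "finite J" using P J by (rule rev_finite_subset)
  have IH: "moebius P t b = (\<Sum>K\<in>P - J. moebius P K b * f t K)" if "t \<in> {t \<in> J. x < t}" for t
  proof -
    have "{s \<in> P. t < s} \<subset> {s \<in> P. x < s}" using that J by auto
    then have "card {s \<in> P. t < s} < card {s \<in> P. x < s}"
      using P by (simp add: psubset_card_mono)
    with less.hyps that show ?thesis unfolding f_def by blast
  qed
  have weight: "f x K = - (\<Sum>t\<in>{t \<in> J. x < t}. f t K) - (if x < K then 1 else 0)"
    if K: "K \<in> P - J" for K
  proof (cases "x < K")
    case True
    have "{t \<in> insert K {t \<in> J. t \<le> K}. x < t \<and> t \<le> K} = insert K {t \<in> J. x < t \<and> t \<le> K}"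
      using True by auto
    then have "f x K = - (\<Sum>t\<in>insert K {t \<in> J. x < t \<and> t \<le> K}. f t K)"
      using True finJ less.prems
      by (simp add: f_def moebius.simps [of "insert K {t \<in> J. t \<le> K}" x K] less_le)
    also have "\<dots> = - (\<Sum>t\<in>{t \<in> J. x < t \<and> t \<le> K}. f t K) - 1"
      using K finJ by (simp add: f_def moebius_refl)
    also have "(\<Sum>t\<in>{t \<in> J. x < t \<and> t \<le> K}. f t K) = (\<Sum>t\<in>{t \<in> J. x < t}. f t K)"
      using finJ by (intro sum.mono_neutral_left) (auto simp: f_def moebius_eq_0)
    finally show ?thesis using True by simp
  next
    case False
    with K less.prems have "\<not> x \<le> K" by (auto simp: less_le)
    moreover from this have "\<not> t \<le> K" if "x < t" for t using that by fastforce
    ultimately show ?thesis by (simp add: f_def moebius_eq_0 less_le)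
  qed
  have expand: "moebius P x b = - (\<Sum>t\<in>{t \<in> P. x < t}. moebius P t b)"
  proof (cases "x \<le> b")
    case True
    then have "moebius P x b = - (\<Sum>t\<in>{t \<in> P. x < t \<and> t \<le> b}. moebius P t b)"
      using P J b less.prems by (auto simp: moebius.simps [of P x b])
    also have "(\<Sum>t\<in>{t \<in> P. x < t \<and> t \<le> b}. moebius P t b) = (\<Sum>t\<in>{t \<in> P. x < t}. moebius P t b)"
      using P by (intro sum.mono_neutral_left) (auto simp: moebius_eq_0)
    finally show ?thesis .
  next
    case False
    then have "\<not> t \<le> b" if "x < t" for t using that by fastforce
    with False show ?thesis by (simp add: moebius_eq_0)
  qed
  have "{t \<in> P. x < t} = {t \<in> J. x < t} \<union> {t \<in> P - J. x < t}" using J by auto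
  then have "(\<Sum>t\<in>{t \<in> P. x < t}. moebius P t b)
      = (\<Sum>t\<in>{t \<in> J. x < t}. moebius P t b) + (\<Sum>K\<in>{K \<in> P - J. x < K}. moebius P K b)"
    using P finJ by (simp only:) (rule sum.union_disjoint, auto)
  also have "(\<Sum>t\<in>{t \<in> J. x < t}. moebius P t b)
      = (\<Sum>K\<in>P - J. moebius P K b * (\<Sum>t\<in>{t \<in> J. x < t}. f t K))"
    by (simp only: sum_distrib_left) (subst sum.swap, rule sum.cong [OF refl IH])
  also have "(\<Sum>K\<in>{K \<in> P - J. x < K}. moebius P K b)
      = (\<Sum>K\<in>P - J. moebius P K b * (if x < K then 1 else 0))"
    using P by (intro sum.mono_neutral_cong_left) auto
  finally have "moebius P x b = - (\<Sum>K\<in>P - J. moebius P K b *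
      ((\<Sum>t\<in>{t \<in> J. x < t}. f t K) + (if x < K then 1 else 0)))"
    using expand by (simp add: sum.distrib distrib_left)
  also have "\<dots> = (\<Sum>K\<in>P - J. moebius P K b * f x K)"
    unfolding sum_negf [symmetric] by (rule sum.cong) (simp_all add: weight algebra_simps)
  finally show ?case by (simp add: f_def)
qed

lemma stab_ideal_eq:
  "stab_ideal G \<phi> K H = {L \<in> overgroups G H. L \<subseteq> K \<and> \<not> irreducible_subgroup \<phi> L}"
proof -
  have "(\<exists>M\<in>stab_family G \<phi> K H. L \<subseteq> M) \<longleftrightarrow> \<not> irreducible_subgroup \<phi> L"
    if "L \<subseteq> K" "H \<subseteq> L" for L
  proof -
    let ?S = "\<lambda>W. stabilizer (G\<lparr>carrier := K\<rparr>) \<phi> W"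
    have "(\<exists>M\<in>stab_family G \<phi> K H. L \<subseteq> M) \<longleftrightarrow>
        (\<exists>W. vec.subspace W \<and> W \<noteq> {0} \<and> W \<noteq> UNIV \<and> H \<subseteq> ?S W \<and> L \<subseteq> ?S W)"
      unfolding stab_family_def by blast
    moreover have "H \<subseteq> ?S W \<and> L \<subseteq> ?S W \<longleftrightarrow> (\<forall>g\<in>L. \<phi> g W = W)" for W
      using that by (auto simp: stabilizer_def)
    ultimately show ?thesis
      unfolding irreducible_subgroup_def invariant_subspace_def by auto
  qed
  then show ?thesis unfolding stab_ideal_def overgroups_def by blast
qed

text \<open>
  \<open>GL\<close> and \<open>PGL\<close> are treated at once: what the two formulas require of the action is that the
  whole group be irreducible.
\<close>

lemma moebius_irreducible_overgroups:
  fixes G :: "('g, 'm) monoid_scheme" and \<phi> :: "'g \<Rightarrow> ('a::field^'n) set \<Rightarrow> ('a^'n) set"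
  assumes G: "group G" and fin: "finite (carrier G)"
    and irr: "irreducible_subgroup \<phi> (carrier G)" and H: "subgroup H G"
  shows "moebius (overgroups G H) H (carrier G)
          = moebius (stab_ideal_hat G \<phi> (carrier G) H) H (carrier G)
            + (\<Sum>K\<in>{K. subgroup K G \<and> H \<subset> K \<and> K \<subset> carrier G
                        \<and> K \<notin> stab_ideal G \<phi> (carrier G) H}.
                 moebius (overgroups G H) K (carrier G) * moebius (stab_ideal_hat G \<phi> K H) H K)"
      (is ?isolated)
    and "\<not> irreducible_subgroup \<phi> H \<or> H = carrier G \<Longrightarrow>
          moebius (overgroups G H) H (carrier G)
            = (\<Sum>K\<in>Irr G \<phi> H.
                 moebius (overgroups G H) K (carrier G) * moebius (stab_ideal_hat G \<phi> K H) H K)"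
      (is "_ \<Longrightarrow> ?Irr_sum")
proof -
  let ?P = "overgroups G H" and ?G = "carrier G"
  define J where "J = insert H {L \<in> ?P. \<not> irreducible_subgroup \<phi> L}"
  have le: "K \<subseteq> ?G" if "K \<in> ?P" for K
    using that by (auto simp: overgroups_def dest: subgroup.subset)
  then have finP: "finite ?P"
    by (intro finite_subset [of ?P "Pow ?G"]) (auto simp: fin)
  have GP: "?G \<in> ?P" and HP: "H \<in> ?P"
    using H group.subgroup_self [OF G] subgroup.subset [OF H] by (auto simp: overgroups_def)
  have JP: "J \<subseteq> ?P" using HP by (auto simp: J_def)
  have hat: "stab_ideal_hat G \<phi> K H = insert K {t \<in> J. t \<le> K}" if "K \<in> ?P" for K
    using that by (auto simp: stab_ideal_hat_def stab_ideal_eq J_def overgroups_def)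
  have split: "moebius ?P H ?G
      = (\<Sum>K\<in>?P - J. moebius ?P K ?G * moebius (stab_ideal_hat G \<phi> K H) H K)" if "H \<noteq> ?G"
  proof -
    have "?G \<notin> J" using irr that by (auto simp: J_def)
    then have "moebius ?P H ?G
        = (\<Sum>K\<in>?P - J. moebius ?P K ?G * moebius (insert K {t \<in> J. t \<le> K}) H K)"
      using finP JP GP by (intro moebius_split_at_subset) (auto simp: J_def)
    then show ?thesis by (simp add: hat cong: sum.cong_simp)
  qed
  have triv: "moebius ?P H H = 1" "moebius (stab_ideal_hat G \<phi> H H) H H = 1"
    using finP HP JP by (auto simp: hat intro!: moebius_refl intro: finite_subset)
  show ?isolated
  proof (cases "H = ?G")
    case True
    then have no_K: "{K. subgroup K G \<and> H \<subset> K \<and> K \<subset> ?G \<and> K \<notin> stab_ideal G \<phi> ?G H} = {}"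
      by auto
    show ?thesis unfolding no_K using True triv by simp
  next
    case False
    have "?P - J = insert ?G {K. subgroup K G \<and> H \<subset> K \<and> K \<subset> ?G \<and> K \<notin> stab_ideal G \<phi> ?G H}"
      using False irr GP le by (auto simp: J_def stab_ideal_eq overgroups_def)
    moreover have "finite {K. subgroup K G \<and> H \<subset> K \<and> K \<subset> ?G \<and> K \<notin> stab_ideal G \<phi> ?G H}"
      by (rule finite_subset [OF _ finP]) (auto simp: overgroups_def)
    ultimately show ?thesis
      using split [OF False] finP GP by (simp add: moebius_refl)
  qed
  show ?Irr_sum if "\<not> irreducible_subgroup \<phi> H \<or> H = ?G"
  proof (cases "H = ?G")
    case True
    then have "Irr G \<phi> H = {H}"
      using irr HP le by (auto simp: Irr_def overgroups_def)
    with True triv show ?thesis by simp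
  next
    case False
    with that have "Irr G \<phi> H = ?P - J"
      using HP by (auto simp: Irr_def J_def)
    with split [OF False] show ?thesis by simp
  qed
qed

text \<open>
  A proper nonzero subspace is moved by the linear involution that extends the exchange of a
  nonzero vector \<open>w\<close> inside it with a vector \<open>u\<close> outside it to a basis containing both.
\<close>

lemma irreducible_GL:
  "irreducible_subgroup GL_action (carrier (GL :: ('a::field^'n \<Rightarrow> 'a^'n) monoid))"
  unfolding irreducible_subgroup_def
proof (intro allI impI, rule ccontr)
  fix W :: "('a^'n) set"
  assume inv: "invariant_subspace GL_action (carrier GL) W" and "\<not> (W = {0} \<or> W = UNIV)"
  then have W: "vec.subspace W" "W \<noteq> {0}" "W \<noteq> UNIV" by (auto simp: invariant_subspace_def)
  then obtain w u where w: "w \<in> W" "w \<noteq> 0" and u: "u \<notin> W"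
    using vec.subspace_0 by blast
  have "u \<notin> vec.span {w}" using vec.span_minimal [of "{w}" W] W w u by auto
  then have ind: "vec.independent {u, w}"
    using w vec.independent_insert [of u "{w}"] vec.dependent_single by auto
  define B where "B = vec.extend_basis {u, w}"
  have B: "{u, w} \<subseteq> B" "vec.independent B" "vec.span B = UNIV"
    using vec.extend_basis_superset [OF ind] vec.independent_extend_basis [OF ind]
      vec.span_extend_basis [OF ind] by (simp_all add: B_def)
  define g where "g = vec.construct B (Transposition.transpose u w)"
  have lin: "Vector_Spaces.linear (*s) (*s) g"
    unfolding g_def by (rule vec.linear_construct [OF B(2)])
  have gB: "g v = Transposition.transpose u w v" if "v \<in> B" for v
    unfolding g_def using that by (simp add: vec.construct_basis [OF B(2)])
  have "(g \<circ> g) v = id v" if "v \<in> B" for v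
    using that B(1) gB by (auto simp: Transposition.transpose_def)
  then have "(g \<circ> g) v = id v" for v
    using vec.linear_eq_on_span [OF Vector_Spaces.linear_compose [OF lin lin] vec.linear_id, of B]
      B(3) by auto
  then have "bij g" by (metis ext o_bij)
  with lin inv have "g ` W = W"
    by (auto simp: invariant_subspace_def GL_action_def GL_def)
  moreover have "g w = u" using gB B(1) by simp
  ultimately show False using w u by blast
qed

text \<open>
  The coset of a linear map acts on a subspace like the map itself, so a subspace that is invariant
  under \<open>PGL\<close> is invariant under \<open>GL\<close>.
\<close>

lemma irreducible_PGL:
  "irreducible_subgroup PGL_action (carrier (PGL :: ('a::field^'n \<Rightarrow> 'a^'n) set monoid))"
proof -
  have "invariant_subspace GL_action (carrier GL) W"
    if inv: "invariant_subspace PGL_action (carrier PGL) W" for W :: "('a^'n) set"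
    unfolding invariant_subspace_def
  proof (intro conjI ballI)
    show W: "vec.subspace W" using inv by (simp add: invariant_subspace_def)
    fix g :: "'a^'n \<Rightarrow> 'a^'n"
    assume g: "g \<in> carrier GL"
    then have "group_center GL #>\<^bsub>GL\<^esub> g \<in> carrier PGL"
      by (auto simp: PGL_def FactGroup_def RCOSETS_def)
    with inv have "PGL_action (group_center GL #>\<^bsub>GL\<^esub> g) W = W"
      by (simp add: invariant_subspace_def)
    with PGL_action_coset [OF g W] show "GL_action g W = W" by simp
  qed
  with irreducible_GL show ?thesis unfolding irreducible_subgroup_def by blast
qed

theorem theorem3p4:
  shows
    "(\<forall>H. subgroup H (GL :: ('a::{field,finite}^'n \<Rightarrow> 'a^'n) monoid) \<longrightarrow>
        moebius (overgroups GL H) H (carrier GL)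
          = moebius (stab_ideal_hat GL GL_action (carrier GL) H) H (carrier GL)
            + (\<Sum>K\<in>{K. subgroup K GL \<and> H \<subset> K \<and> K \<subset> carrier GL
                        \<and> K \<notin> stab_ideal GL GL_action (carrier GL) H}.
                 moebius (overgroups GL H) K (carrier GL)
                   * moebius (stab_ideal_hat GL GL_action K H) H K)
        \<and> (\<not> irreducible_subgroup GL_action H \<or> H = carrier GL \<longrightarrow>
            moebius (overgroups GL H) H (carrier GL)
              = (\<Sum>K\<in>Irr GL GL_action H.
                   moebius (overgroups GL H) K (carrier GL)
                     * moebius (stab_ideal_hat GL GL_action K H) H K)))
   \<and> (\<forall>H. subgroup H (PGL :: ('a^'n \<Rightarrow> 'a^'n) set monoid) \<longrightarrow>
        moebius (overgroups PGL H) H (carrier PGL)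
          = moebius (stab_ideal_hat PGL PGL_action (carrier PGL) H) H (carrier PGL)
            + (\<Sum>K\<in>{K. subgroup K PGL \<and> H \<subset> K \<and> K \<subset> carrier PGL
                        \<and> K \<notin> stab_ideal PGL PGL_action (carrier PGL) H}.
                 moebius (overgroups PGL H) K (carrier PGL)
                   * moebius (stab_ideal_hat PGL PGL_action K H) H K)
        \<and> (\<not> irreducible_subgroup PGL_action H \<or> H = carrier PGL \<longrightarrow>
            moebius (overgroups PGL H) H (carrier PGL)
              = (\<Sum>K\<in>Irr PGL PGL_action H.
                   moebius (overgroups PGL H) K (carrier PGL)
                     * moebius (stab_ideal_hat PGL PGL_action K H) H K)))"
  by (intro conjI allI impI)
    (rule moebius_irreducible_overgroups [OF group_GL finite irreducible_GL]
      moebius_irreducible_overgroups [OF group_PGL finite irreducible_PGL]; assumption)+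

end
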